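(* Let $L_n$ be the para-chain hexagonal graph of order $n$. Then: (i) for every $n\geq 1$ and $k\geq 1$, $$ABC_{GG}(L_n)=12\sum_{i=1}^{k}\sqrt{\frac{10k-1}{(10k-5i+3)(5i-2)}}\quad\text{if } n=2k,$$ $$ABC_{GG}(L_n)=12\left(\sum_{i=1}^{k}\sqrt{\frac{10k+4}{(10k-5i+8)(5i-2)}}\right)+\frac{6\sqrt{10k+4}}{5k+3}\quad\text{if } n=2k+1;$$ (ii) for every $n\geq 2$, $ABC(L_n)=3n\sqrt{2}$.
   Context: For a finite simple graph $G$, $ABC(G)=\sum_{uv\in E(G)}\sqrt{\frac{d_u+d_v-2}{d_ud_v}}$, where $d_u$ is the degree of $u$ in $G$. For an edge $uv$ of $G$, $n_u(uv,G)$ is the number of vertices of $G$ strictly closer to $u$ than to $v$, and $n_v(uv,G)$ is defined analogously; equidistant vertices are not counted. $ABC_{GG}(G)=\sum_{uv\in E(G)}\sqrt{\frac{n_u(uv,G)+n_v(uv,G)-2}{n_u(uv,G)n_v(uv,G)}}$. The para-chain hexagonal graph $L_n$ of order $n$ consists of $n$ hexagons glued in a chain at opposite vertices: take $n$ disjoint 6-cycles, choose in the $i$-th one two opposite vertices $x_i,y_i$ (at distance 3), and identify $y_i$ with $x_{i+1}$ for $i=1,\ldots,n-1$. *)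

theory Defs
  imports Complex_Main "HOL-Library.Extended_Nat"
begin

record 'a ugraph =
  verts :: "'a set"
  edges :: "'a set set"

definition finite_simple_graph :: "'a ugraph \<Rightarrow> bool" where
  "finite_simple_graph G \<longleftrightarrow>
     finite (verts G) \<and> (\<forall>e\<in>edges G. e \<subseteq> verts G \<and> card e = 2)"

definition degree :: "'a ugraph \<Rightarrow> 'a \<Rightarrow> nat" where
  "degree G u = card {e \<in> edges G. u \<in> e}"

definition adj :: "'a ugraph \<Rightarrow> ('a \<times> 'a) set" where
  "adj G = {(u, v). {u, v} \<in> edges G}"

text \<open>Length of a shortest walk; vertices in different components have distance \<open>\<infinity>\<close>.\<close>

definition gdist :: "'a ugraph \<Rightarrow> 'a \<Rightarrow> 'a \<Rightarrow> enat" where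
  "gdist G u v = (INF k \<in> {k. (u, v) \<in> adj G ^^ k}. enat k)"

text \<open>The number written \<open>n\<^sub>u(uv, G)\<close>; the other one, \<open>n\<^sub>v(uv, G)\<close>, is \<open>closer G v u\<close>.\<close>

definition closer :: "'a ugraph \<Rightarrow> 'a \<Rightarrow> 'a \<Rightarrow> nat" where
  "closer G u v = card {w \<in> verts G. gdist G w u < gdist G w v}"

text \<open>The sum of \<open>f u v\<close> over the unordered edges \<open>uv\<close>, each counted once. It is meaningful
  for symmetric \<open>f\<close>, where the value does not depend on the orientation of the edge.\<close>

definition edge_sum :: "'a ugraph \<Rightarrow> ('a \<Rightarrow> 'a \<Rightarrow> real) \<Rightarrow> real" where
  "edge_sum G f = (\<Sum>e\<in>edges G. THE r. \<forall>u v. e = {u, v} \<longrightarrow> r = f u v)"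

lemma edge_sum_summand:
  fixes f :: "'a \<Rightarrow> 'a \<Rightarrow> real"
  assumes "\<And>u v. f u v = f v u"
  shows "(THE r. \<forall>u v. {a, b} = {u, v} \<longrightarrow> r = f u v) = f a b"
proof (rule the_equality)
  show "\<forall>u v. {a, b} = {u, v} \<longrightarrow> f a b = f u v"
    using assms by (metis doubleton_eq_iff)
qed blast

definition ABC :: "'a ugraph \<Rightarrow> real" where
  "ABC G = edge_sum G (\<lambda>u v.
     sqrt ((real (degree G u) + real (degree G v) - 2) /
           (real (degree G u) * real (degree G v))))"

definition ABC_GG :: "'a ugraph \<Rightarrow> real" where
  "ABC_GG G = edge_sum G (\<lambda>u v.
     sqrt ((real (closer G u v) + real (closer G v u) - 2) /
           (real (closer G u v) * real (closer G v u))))"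

text \<open>The disjoint union of \<open>n\<close> 6-cycles: the \<open>i\<close>-th one has the vertices \<open>(i, 0), \<dots>, (i, 5)\<close> in
  cyclic order. Its chosen opposite vertices are \<open>x\<^sub>i = (i, 0)\<close> and \<open>y\<^sub>i = (i, 3)\<close>.\<close>

definition hexagons :: "nat \<Rightarrow> (nat \<times> nat) ugraph" where
  "hexagons n = \<lparr>verts = {1..n} \<times> {..<6},
     edges = {{(i, j), (i, (j + 1) mod 6)} | i j. i \<in> {1..n} \<and> j < 6}\<rparr>"

text \<open>The identification of \<open>y\<^sub>i\<close> with \<open>x\<^sub>i\<^sub>+\<^sub>1\<close>, as the map sending each vertex to the
  representative of its class; \<open>y\<^sub>n\<close> is not identified with anything.\<close>

definition glue :: "nat \<Rightarrow> nat \<times> nat \<Rightarrow> nat \<times> nat" where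
  "glue n = (\<lambda>(i, j). if j = 3 \<and> i < n then (i + 1, 0) else (i, j))"

definition para_chain :: "nat \<Rightarrow> (nat \<times> nat) ugraph" where
  "para_chain n = \<lparr>verts = glue n ` verts (hexagons n),
     edges = (\<lambda>e. glue n ` e) ` edges (hexagons n)\<rparr>"

lemma finite_simple_graph_para_chain: "finite_simple_graph (para_chain n)"
proof -
  have "glue n ` e \<subseteq> glue n ` verts (hexagons n) \<and> card (glue n ` e) = 2"
    if "e \<in> edges (hexagons n)" for e
  proof -
    from that obtain i j where e: "e = {(i, j), (i, (j + 1) mod 6)}" "i \<in> {1..n}" "j < 6"
      by (auto simp: hexagons_def)
    then have "e \<subseteq> verts (hexagons n)"
      by (auto simp: hexagons_def)
    moreover have "(j + 1) mod 6 \<noteq> j"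
      using e(3) by presburger
    then have "glue n (i, j) \<noteq> glue n (i, (j + 1) mod 6)"
      by (auto simp: glue_def)
    ultimately show ?thesis
      using e(1) by auto
  qed
  then show ?thesis
    by (auto simp: finite_simple_graph_def para_chain_def hexagons_def)
qed

end

theory Submission
  imports Defs
begin

text \<open>
  Both indices are sums over the six edges of each of the \<open>n\<close> hexagons, and all six edges of a
  hexagon contribute the same amount.

  For the Graovac--Ghorbani index, let \<open>uv\<close> be an edge of the \<open>i\<close>-th hexagon. Removing \<open>uv\<close> and
  the edge opposite to it cuts \<open>L\<^sub>n\<close> into two parts, and each vertex is closer to the endpoint of
  \<open>uv\<close> that lies in its own part (\<open>closer_eq_side\<close>). This is seen without computing any distance:
  reflecting the hexagon across the cut, and collapsing the rest of the far part onto the mirror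
  image of the vertex where it is attached, gives a map that fixes the near part and sends every
  edge to an edge or to a single vertex. A walk from the near part to the far endpoint crosses the
  cut, and the map shortens it to a walk to the near endpoint (\<open>gdist_less_by_folding\<close>). Opposite
  vertices of a hexagon are always separated by the cut, so one part contains three vertices of the
  hexagon and all earlier hexagons, hence \<open>5 * i - 2\<close> vertices, and the other one contains the
  remaining \<open>5 * (n - i) + 3\<close> of the \<open>5 * n + 1\<close> vertices (\<open>card_sides\<close>). Each edge of the \<open>i\<close>-th
  hexagon therefore contributes
  \<open>sqrt ((5 * n - 1) / ((5 * (n - i) + 3) * (5 * i - 2)))\<close>, which is invariant under
  \<open>i \<mapsto> n + 1 - i\<close>. Pairing \<open>i\<close> with \<open>n + 1 - i\<close> gives the two closed forms; for odd \<open>n\<close> the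
  middle hexagon is left over.

  For the ABC index, every edge has an endpoint of degree 2, because two vertices at which hexagons
  are glued are never adjacent. If \<open>d\<close> is the degree of the other endpoint, the contribution is
  \<open>sqrt ((2 + d - 2) / (2 * d)) = sqrt (1 / 2)\<close>, which is the same for all \<open>d > 0\<close>.
\<close>

section \<open>Comparing distances by folding\<close>

text \<open>
  The image under \<open>\<phi>\<close> of a walk that starts in \<open>A\<close> is again a walk with the same start, and it is
  no longer. The step with which the walk leaves \<open>A\<close> is collapsed, so a walk that ends outside
  \<open>A\<close> becomes strictly shorter.
\<close>

lemma gdist_less_by_folding:
  assumes fixed: "\<And>x. x \<in> A \<Longrightarrow> \<phi> x = x"
    and edge: "\<And>x y. (x, y) \<in> adj G \<Longrightarrow> \<phi> x = \<phi> y \<or> (\<phi> x, \<phi> y) \<in> adj G"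
    and cross: "\<And>x y. (x, y) \<in> adj G \<Longrightarrow> x \<in> A \<Longrightarrow> y \<notin> A \<Longrightarrow> \<phi> y = x"
    and "w \<in> A" "v \<notin> A" and reach: "(w, v) \<in> (adj G)\<^sup>*"
  shows "gdist G w (\<phi> v) < gdist G w v"
proof -
  have fold_walk: "\<exists>k'\<le>k. (w, \<phi> z) \<in> adj G ^^ k' \<and> (z \<notin> A \<longrightarrow> k' < k)"
    if "(w, z) \<in> adj G ^^ k" for k z
    using that
  proof (induction k arbitrary: z)
    case 0
    then show ?case using \<open>w \<in> A\<close> fixed by auto
  next
    case (Suc k)
    then obtain y where y: "(w, y) \<in> adj G ^^ k" "(y, z) \<in> adj G"
      by auto
    from Suc.IH[OF y(1)] obtain k' where
      k': "k' \<le> k" "(w, \<phi> y) \<in> adj G ^^ k'" "y \<notin> A \<longrightarrow> k' < k"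
      by blast
    show ?case
    proof (cases "\<phi> y = \<phi> z")
      case True
      then show ?thesis using k' by (intro exI[of _ k']) auto
    next
      case False
      then have "(\<phi> y, \<phi> z) \<in> adj G" using edge[OF y(2)] by simp
      then have "(w, \<phi> z) \<in> adj G ^^ Suc k'" using k'(2) by auto
      moreover have "z \<notin> A \<longrightarrow> y \<notin> A"
        using False cross[OF y(2)] fixed by metis
      ultimately show ?thesis using k' by (intro exI[of _ "Suc k'"]) auto
    qed
  qed
  \<comment> \<open>Since \<open>v\<close> is reachable, the distance is attained by a shortest walk, which is then folded.\<close>
  define K where "K = {k. (w, v) \<in> adj G ^^ k}"
  have "K \<noteq> {}" using reach by (auto simp: K_def rtrancl_power)
  then have "(LEAST k. k \<in> K) \<in> K" by (auto intro: LeastI)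
  then obtain k' where k': "k' < (LEAST k. k \<in> K)" "(w, \<phi> v) \<in> adj G ^^ k'"
    using fold_walk[of v "LEAST k. k \<in> K"] \<open>v \<notin> A\<close> by (auto simp: K_def)
  have "gdist G w (\<phi> v) \<le> enat k'"
    unfolding gdist_def by (rule INF_lower) (use k' in simp)
  also have "\<dots> < enat (LEAST k. k \<in> K)" using k' by simp
  also have "\<dots> \<le> gdist G w v"
    unfolding gdist_def by (rule INF_greatest) (auto simp: K_def intro: Least_le)
  finally show ?thesis .
qed

section \<open>The hexagons of the chain\<close>

definition hex_edge :: "nat \<Rightarrow> nat \<Rightarrow> nat \<Rightarrow> (nat \<times> nat) set" where
  "hex_edge n m j = {glue n (m, j), glue n (m, (j + 1) mod 6)}"

lemma edges_para_chain:
  "edges (para_chain n) = (\<lambda>(m, j). hex_edge n m j) ` ({1..n} \<times> {..<6})"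
proof -
  have "edges (hexagons n) =
      (\<lambda>(m, j). {(m, j), (m, (j + 1) mod 6)}) ` ({1..n} \<times> {..<6})"
    unfolding hexagons_def by (auto simp: image_iff) blast
  then show ?thesis
    by (simp add: para_chain_def hex_edge_def image_image case_prod_unfold)
qed

lemma verts_para_chain: "verts (para_chain n) = glue n ` ({1..n} \<times> {..<6})"
  by (simp add: para_chain_def hexagons_def)

lemma finite_edges_para_chain: "finite (edges (para_chain n))"
  by (simp add: edges_para_chain)

lemma adj_para_chainE:
  assumes "(x, y) \<in> adj (para_chain n)"
  obtains m j where "m \<in> {1..n}" "j < 6"
    "x = glue n (m, j) \<and> y = glue n (m, (j + 1) mod 6) \<or>
     y = glue n (m, j) \<and> x = glue n (m, (j + 1) mod 6)"
proof -
  from assms obtain m j where "m \<in> {1..n}" "j < 6" "{x, y} = hex_edge n m j"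
    by (auto simp: adj_def edges_para_chain)
  then show thesis using that[of m j] unfolding hex_edge_def doubleton_eq_iff by blast
qed

lemma adj_para_chainI:
  assumes "m \<in> {1..n}" "j < 6"
  shows "(glue n (m, j), glue n (m, (j + 1) mod 6)) \<in> adj (para_chain n)"
  using assms unfolding adj_def edges_para_chain hex_edge_def by blast

lemma sym_adj: "sym (adj G)"
  by (auto simp: sym_def adj_def insert_commute)

lemma para_chain_connected:
  assumes "w \<in> verts (para_chain n)" "v \<in> verts (para_chain n)"
  shows "(w, v) \<in> (adj (para_chain n))\<^sup>*"
proof -
  let ?R = "(adj (para_chain n))\<^sup>*"
  have around: "(glue n (m, 0), glue n (m, j)) \<in> ?R" if "m \<in> {1..n}" "j < 6" for m j
    using that(2)
  proof (induction j)
    case (Suc j)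
    then show ?case
      using adj_para_chainI[OF that(1), of j] by (auto intro: rtrancl_into_rtrancl)
  qed simp
  have start: "(glue n (1, 0), glue n (m, 0)) \<in> ?R" if "1 \<le> m" "m \<le> n" for m
    using that
  proof (induction m rule: dec_induct)
    case (step m)
    then have "glue n (m, 3) = glue n (Suc m, 0)" by (simp add: glue_def)
    moreover have "(glue n (m, 0), glue n (m, 3)) \<in> ?R"
      using step by (intro around) auto
    ultimately show ?case using step by (metis Suc_leD rtrancl_trans)
  qed simp
  have "(glue n (1, 0), z) \<in> ?R" if "z \<in> verts (para_chain n)" for z
  proof -
    from that obtain m j where z: "z = glue n (m, j)" "m \<in> {1..n}" "j < 6"
      by (auto simp: verts_para_chain)
    then have "(glue n (1, 0), glue n (m, 0)) \<in> ?R" by (intro start) auto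
    then show ?thesis using around[OF z(2,3)] z(1) by (metis rtrancl_trans)
  qed
  then show ?thesis
    using assms sym_rtrancl[OF sym_adj] by (meson rtrancl_trans symD)
qed

text \<open>
  The retraction of the chain onto its \<open>i\<close>-th hexagon: earlier hexagons collapse to \<open>x\<^sub>i\<close> and later
  ones to \<open>y\<^sub>i\<close>, written as the positions 0 and 3.
\<close>

definition hex_proj :: "nat \<Rightarrow> nat \<times> nat \<Rightarrow> nat" where
  "hex_proj i w = (if fst w < i then 0 else if fst w = i then snd w else 3)"

text \<open>
  The position of \<open>(i, 3)\<close> is 3 even when it has been renamed to \<open>(i + 1, 0)\<close>, so that below the
  hexagons can be treated without regard to the choice of representatives.
\<close>

lemma hex_proj_glue:
  "hex_proj i (glue n (m, j)) = (if m < i then 0 else if m = i then j else 3)"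
  by (auto simp: hex_proj_def glue_def)

lemma less_6_cases: "(j::nat) < 6 \<Longrightarrow> j = 0 \<or> j = 1 \<or> j = 2 \<or> j = 3 \<or> j = 4 \<or> j = 5"
  by arith

lemma hexagon_side_inj:
  fixes j q :: nat
  assumes "{j, (j + 1) mod 6} = {q, (q + 1) mod 6}" "j < 6" "q < 6"
  shows "j = q"
  using less_6_cases[OF assms(2)] less_6_cases[OF assms(3)] assms(1)
  by (elim disjE; simp add: doubleton_eq_iff)

text \<open>
  Two hexagons share at most one vertex: the retraction onto one of them keeps its own edges apart
  and collapses every edge of another hexagon to a point.
\<close>

lemma hex_edge_inj: "inj_on (\<lambda>(m, j). hex_edge n m j) ({1..n} \<times> {..<6})"
proof -
  have "m = p \<and> j = q"
    if "hex_edge n m j = hex_edge n p q" "j < 6" "q < 6" for m j p q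
  proof -
    have "hex_proj m ` hex_edge n m j = {j, (j + 1) mod 6}"
      by (simp add: hex_edge_def hex_proj_glue)
    then have *: "{j, (j + 1) mod 6} = hex_proj m ` hex_edge n p q"
      using that(1) by simp
    have "j \<noteq> (j + 1) mod 6" using that(2) by presburger
    then have "p = m" using *
      by (auto simp: hex_edge_def hex_proj_glue doubleton_eq_iff split: if_splits)
    moreover from this have "{j, (j + 1) mod 6} = {q, (q + 1) mod 6}"
      using * by (simp add: hex_edge_def hex_proj_glue)
    ultimately show ?thesis using hexagon_side_inj that(2,3) by blast
  qed
  then show ?thesis by (auto simp: inj_on_def)
qed

lemma edge_sum_para_chain:
  fixes f :: "nat \<times> nat \<Rightarrow> nat \<times> nat \<Rightarrow> real"
  assumes "\<And>u v. f u v = f v u"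
  shows "edge_sum (para_chain n) f =
    (\<Sum>m=1..n. \<Sum>j<6. f (glue n (m, j)) (glue n (m, (j + 1) mod 6)))"
proof -
  have "(THE r. \<forall>u v. hex_edge n m j = {u, v} \<longrightarrow> r = f u v) =
      f (glue n (m, j)) (glue n (m, (j + 1) mod 6))" for m j
    unfolding hex_edge_def by (rule edge_sum_summand) (rule assms)
  then show ?thesis
    unfolding edge_sum_def edges_para_chain sum.reindex[OF hex_edge_inj]
    by (simp add: sum.cartesian_product case_prod_unfold)
qed

section \<open>The cut belonging to an edge\<close>

text \<open>
  The three vertices of a 6-cycle that are closer to \<open>a\<close> than to the next vertex \<open>a + 1\<close>.
  The additions of 4 and 5 are subtractions of 2 and 1 modulo 6.
\<close>

definition half_hexagon :: "nat \<Rightarrow> nat set" where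
  "half_hexagon a = {(a + 4) mod 6, (a + 5) mod 6, a}"

text \<open>
  The reflection \<open>j \<mapsto> 2 * a + 1 - j\<close> of the 6-cycle, which swaps the endpoints of the edge from
  \<open>a\<close> to \<open>a + 1\<close>. The constant is 7 instead of 1 to keep the difference nonnegative for \<open>j < 6\<close>.
\<close>

definition reflect :: "nat \<Rightarrow> nat \<Rightarrow> nat" where
  "reflect a j = (2 * a + 7 - j) mod 6"

lemma reflect_side:
  assumes "a < 6" "j < 6"
  shows "reflect a ((j + 1) mod 6) < 6"
    and "reflect a j = (reflect a ((j + 1) mod 6) + 1) mod 6"
  using less_6_cases[OF assms(1)] less_6_cases[OF assms(2)]
  by (elim disjE; simp add: reflect_def)+

text \<open>
  The edges that cross the cut are the one from \<open>a\<close> to \<open>a + 1\<close> and its opposite, and the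
  reflection swaps the endpoints of both.
\<close>

lemma reflect_crossing:
  assumes "a < 6" "j < 6" "(j \<in> half_hexagon a) \<noteq> ((j + 1) mod 6 \<in> half_hexagon a)"
  shows "reflect a j = (j + 1) mod 6" "reflect a ((j + 1) mod 6) = j"
  using less_6_cases[OF assms(1)] less_6_cases[OF assms(2)] assms(3)
  by (elim disjE; simp add: reflect_def half_hexagon_def)+

lemma half_hexagon_own_edge:
  assumes "a < 6"
  shows "a \<in> half_hexagon a" "(a + 1) mod 6 \<notin> half_hexagon a"
  using less_6_cases[OF assms] by (elim disjE; simp add: half_hexagon_def)+

lemma half_hexagon_antipodes:
  assumes "a < 6"
  shows "(0 \<in> half_hexagon a) \<noteq> (3 \<in> half_hexagon a)"
  using less_6_cases[OF assms] by (elim disjE; simp add: half_hexagon_def)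

lemma half_hexagon_card:
  assumes "a < 6"
  shows "half_hexagon a \<subseteq> {..<6}" "card (half_hexagon a) = 3"
  using less_6_cases[OF assms] by (elim disjE; simp add: half_hexagon_def)+

text \<open>
  The folding argument for the chain. With \<open>S\<close> either half of the \<open>i\<close>-th hexagon, the far part of
  the chain is first collapsed onto the hexagon and then reflected into the near part. Allowing
  both halves for \<open>S\<close> gives the two directions needed for an edge.
\<close>

lemma gdist_less_same_side:
  assumes i: "i \<in> {1..n}" and a: "a < 6" and S: "S = half_hexagon a \<or> S = - half_hexagon a"
    and w: "w \<in> verts (para_chain n)" "hex_proj i w \<in> S"
    and v: "v \<in> verts (para_chain n)" "hex_proj i v \<notin> S"
  shows "gdist (para_chain n) w (glue n (i, reflect a (hex_proj i v))) < gdist (para_chain n) w v"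
proof -
  define A where "A = {x. hex_proj i x \<in> S}"
  define \<phi> where
    "\<phi> x = (if x \<in> A then x else glue n (i, reflect a (hex_proj i x)))" for x
  have crossing: "reflect a j = (j + 1) mod 6" "reflect a ((j + 1) mod 6) = j"
    if "j < 6" "(j \<in> S) \<noteq> ((j + 1) mod 6 \<in> S)" for j
    using reflect_crossing[OF a that(1)] that(2) S by auto
  have edge: "(x \<in> A \<longrightarrow> y \<notin> A \<longrightarrow> \<phi> y = x) \<and> (y \<in> A \<longrightarrow> x \<notin> A \<longrightarrow> \<phi> x = y)
      \<and> (\<phi> x = \<phi> y \<or> (\<phi> x, \<phi> y) \<in> adj (para_chain n))"
    if xy: "x = glue n (m, j)" "y = glue n (m, (j + 1) mod 6)"
      and m: "m \<in> {1..n}" and j: "j < 6" for x y m j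
  \<comment> \<open>An edge of another hexagon lies on one side of the cut: it is fixed or collapsed.\<close>
  proof (cases "m = i")
    case False
    then have "hex_proj i x = hex_proj i y" using xy by (simp add: hex_proj_glue)
    then show ?thesis
      using adj_para_chainI[OF m j] xy by (auto simp: \<phi>_def A_def)
  next
    case True
    then have proj: "hex_proj i x = j" "hex_proj i y = (j + 1) mod 6"
      using xy by (simp_all add: hex_proj_glue)
    show ?thesis
    proof (cases "(j \<in> S) = ((j + 1) mod 6 \<in> S)")
      case False
      then show ?thesis
        using crossing[OF j] xy True proj by (auto simp: \<phi>_def A_def)
    next
      case same: True
      \<comment> \<open>The reflection reverses the orientation of the hexagon.\<close>
      have "(glue n (i, reflect a ((j + 1) mod 6)), glue n (i, reflect a j)) \<in> adj (para_chain n)"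
        using adj_para_chainI[OF i reflect_side(1)[OF a j]] reflect_side(2)[OF a j] by simp
      then have "(glue n (i, reflect a j), glue n (i, reflect a ((j + 1) mod 6))) \<in> adj (para_chain n)"
        by (rule symD[OF sym_adj])
      then show ?thesis
        using adj_para_chainI[OF m j] xy proj same by (auto simp: \<phi>_def A_def)
    qed
  qed
  have "gdist (para_chain n) w (\<phi> v) < gdist (para_chain n) w v"
  proof (rule gdist_less_by_folding[where A = A])
    show "\<phi> x = \<phi> y \<or> (\<phi> x, \<phi> y) \<in> adj (para_chain n)" if "(x, y) \<in> adj (para_chain n)" for x y
      using that edge symD[OF sym_adj] by (metis adj_para_chainE)
    show "\<phi> y = x" if "(x, y) \<in> adj (para_chain n)" "x \<in> A" "y \<notin> A" for x y
      using that edge by (metis adj_para_chainE)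
    show "(w, v) \<in> (adj (para_chain n))\<^sup>*" using para_chain_connected w v by blast
  qed (use w v in \<open>auto simp: \<phi>_def A_def\<close>)
  then show ?thesis using v by (simp add: \<phi>_def A_def)
qed

lemma closer_eq_side:
  assumes i: "i \<in> {1..n}" and a: "a < 6"
  defines "u \<equiv> glue n (i, a)" and "v \<equiv> glue n (i, (a + 1) mod 6)"
  shows "closer (para_chain n) u v = card {w \<in> verts (para_chain n). hex_proj i w \<in> half_hexagon a}"
    and "closer (para_chain n) v u = card {w \<in> verts (para_chain n). hex_proj i w \<notin> half_hexagon a}"
proof -
  let ?d = "gdist (para_chain n)" and ?V = "verts (para_chain n)"
  have V: "u \<in> ?V" "v \<in> ?V" using i a by (auto simp: u_def v_def verts_para_chain)
  have proj: "hex_proj i u = a" "hex_proj i v = (a + 1) mod 6"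
    by (simp_all add: u_def v_def hex_proj_glue)
  have refl: "reflect a a = (a + 1) mod 6" "reflect a ((a + 1) mod 6) = a"
    using reflect_crossing[OF a a] half_hexagon_own_edge[OF a] by auto
  have 1: "?d w u < ?d w v" if "w \<in> ?V" "hex_proj i w \<in> half_hexagon a" for w
    using gdist_less_same_side[OF i a, of "half_hexagon a" w v] that V proj refl half_hexagon_own_edge[OF a]
    by (simp add: u_def)
  have 2: "?d w v < ?d w u" if "w \<in> ?V" "hex_proj i w \<notin> half_hexagon a" for w
    using gdist_less_same_side[OF i a, of "- half_hexagon a" w u] that V proj refl half_hexagon_own_edge[OF a]
    by (simp add: v_def)
  show "closer (para_chain n) u v = card {w \<in> ?V. hex_proj i w \<in> half_hexagon a}"
    unfolding closer_def using 1 2 by (metis (lifting) order_less_asym)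
  show "closer (para_chain n) v u = card {w \<in> ?V. hex_proj i w \<notin> half_hexagon a}"
    unfolding closer_def using 1 2 by (metis (lifting) order_less_asym)
qed

section \<open>Counting the two sides of a cut\<close>

text \<open>
  Position 3 is a representative only in the last hexagon, so that each hexagon accounts for five
  vertices and \<open>y\<^sub>n\<close> for one more.
\<close>

lemma verts_para_chain_reps:
  assumes "n \<ge> 1"
  shows "verts (para_chain n) = insert (n, 3) ({1..n} \<times> {0, 1, 2, 4, 5})"
proof (intro equalityI subsetI)
  fix w assume "w \<in> verts (para_chain n)"
  then obtain m j where "w = glue n (m, j)" "m \<in> {1..n}" "j < 6"
    by (auto simp: verts_para_chain)
  then show "w \<in> insert (n, 3) ({1..n} \<times> {0, 1, 2, 4, 5})"
    using less_6_cases[of j] by (auto simp: glue_def)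
next
  fix w :: "nat \<times> nat" assume w: "w \<in> insert (n, 3) ({1..n} \<times> {0, 1, 2, 4, 5})"
  then have "glue n w = w" "w \<in> {1..n} \<times> {..<6}" using assms by (auto simp: glue_def)
  then show "w \<in> verts (para_chain n)" by (metis image_eqI verts_para_chain)
qed

lemma card_verts_para_chain:
  assumes "n \<ge> 1"
  shows "card (verts (para_chain n)) = 5 * n + 1"
  unfolding verts_para_chain_reps[OF assms]
  by (subst card_insert_disjoint) (auto simp: card_cartesian_product)

text \<open>
  The part of the chain attached to \<open>x\<^sub>i\<close> consists of the \<open>i - 1\<close> earlier hexagons, with five
  representatives each, and the three vertices of \<open>S\<close>.
\<close>

lemma card_initial_side:
  assumes i: "i \<in> {1..n}" and S: "S \<subseteq> {..<6}" "card S = 3" "0 \<in> S" "3 \<notin> S"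
  shows "card {w \<in> verts (para_chain n). hex_proj i w \<in> S} = 5 * i - 2"
proof -
  have n: "n \<ge> 1" using i by simp
  have sub: "j \<in> {0, 1, 2, 4, 5}" if "j \<in> S" for j
    using that S(1,4) less_6_cases[of j] by auto
  have "{w \<in> verts (para_chain n). hex_proj i w \<in> S} =
      {1..<i} \<times> {0, 1, 2, 4, 5} \<union> {i} \<times> S"
    unfolding verts_para_chain_reps[OF n] hex_proj_def
    using i S(3,4) sub by (auto split: if_splits)
  moreover have "finite S" using S(1) finite_subset by blast
  ultimately show ?thesis
    using i S(2) by (simp, subst card_Un_disjoint) (auto simp: card_cartesian_product)
qed

text \<open>
  Which of the two halves contains \<open>x\<^sub>i\<close> depends on \<open>a\<close>, but the contribution of an edge is
  symmetric in the two sizes, so the disjunction suffices.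
\<close>

lemma card_sides:
  assumes i: "i \<in> {1..n}" and a: "a < 6"
  defines "p \<equiv> card {w \<in> verts (para_chain n). hex_proj i w \<in> half_hexagon a}"
    and "q \<equiv> card {w \<in> verts (para_chain n). hex_proj i w \<notin> half_hexagon a}"
  shows "p = 5 * i - 2 \<and> q = 5 * (n - i) + 3 \<or> q = 5 * i - 2 \<and> p = 5 * (n - i) + 3"
proof -
  let ?V = "verts (para_chain n)"
  have fin: "finite ?V" by (simp add: verts_para_chain)
  have "p + q = card ({w \<in> ?V. hex_proj i w \<in> half_hexagon a} \<union> {w \<in> ?V. hex_proj i w \<notin> half_hexagon a})"
    unfolding p_def q_def by (rule card_Un_disjoint[symmetric]) (use fin in auto)
  also have "\<dots> = card ?V" by (rule arg_cong[where f = card]) auto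
  finally have total: "p + q = 5 * n + 1" using i card_verts_para_chain by simp
  show ?thesis
  proof (cases "0 \<in> half_hexagon a")
    case True
    then have "p = 5 * i - 2"
      unfolding p_def using half_hexagon_antipodes[OF a] half_hexagon_card[OF a] i
      by (intro card_initial_side) auto
    then show ?thesis using total i by auto
  next
    case False
    have "{w \<in> ?V. hex_proj i w \<notin> half_hexagon a} = {w \<in> ?V. hex_proj i w \<in> {..<6} - half_hexagon a}"
      by (auto simp: verts_para_chain hex_proj_glue)
    then have "q = card {w \<in> ?V. hex_proj i w \<in> {..<6} - half_hexagon a}"
      unfolding q_def by simp
    also have "\<dots> = 5 * i - 2"
      using False half_hexagon_antipodes[OF a] half_hexagon_card[OF a] i
      by (intro card_initial_side) (auto simp: card_Diff_subset finite_subset)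
    finally show ?thesis using total i by auto
  qed
qed

section \<open>The two indices\<close>

lemma ABC_GG_para_chain:
  "ABC_GG (para_chain n) =
    6 * (\<Sum>i=1..n. sqrt ((5 * real n - 1) / ((5 * real (n - i) + 3) * (5 * real i - 2))))"
proof -
  define F where
    "F u v = sqrt ((real (closer (para_chain n) u v) + real (closer (para_chain n) v u) - 2) /
          (real (closer (para_chain n) u v) * real (closer (para_chain n) v u)))" for u v
  have F_sym: "F u v = F v u" for u v
    by (simp add: F_def add.commute mult.commute)
  have F_edge: "F (glue n (i, a)) (glue n (i, (a + 1) mod 6)) =
      sqrt ((5 * real n - 1) / ((5 * real (n - i) + 3) * (5 * real i - 2)))"
    if i: "i \<in> {1..n}" and a: "a < 6" for i a
  proof -
    have "real (5 * i - 2) = 5 * real i - 2" "real (n - i) = real n - real i"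
      using i by (auto simp: of_nat_diff)
    then show ?thesis
      using card_sides[OF i a] closer_eq_side[OF i a]
      by (auto simp: F_def algebra_simps)
  qed
  have "ABC_GG (para_chain n) = edge_sum (para_chain n) F"
    by (simp add: ABC_GG_def F_def [abs_def])
  also have "\<dots> = (\<Sum>i=1..n. \<Sum>a<6. F (glue n (i, a)) (glue n (i, (a + 1) mod 6)))"
    by (rule edge_sum_para_chain) (rule F_sym)
  also have "\<dots> = (\<Sum>i=1..n. \<Sum>a<6::nat.
      sqrt ((5 * real n - 1) / ((5 * real (n - i) + 3) * (5 * real i - 2))))"
    by (intro sum.cong refl F_edge) auto
  finally show ?thesis by (simp add: sum_distrib_left)
qed

text \<open>
  Away from the two gluing positions a vertex only has its two neighbours in its own hexagon.
\<close>

lemma degree_inner_vertex: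
  assumes m: "m \<in> {1..n}" and j: "j < 6" "j \<noteq> 0" "j \<noteq> 3"
  shows "degree (para_chain n) (glue n (m, j)) = 2"
proof -
  have only: "p = m \<and> q = j" if "glue n (p, q) = glue n (m, j)" for p q
    using that j by (auto simp: glue_def split: if_splits)
  have "{e \<in> edges (para_chain n). glue n (m, j) \<in> e} =
      {hex_edge n m j, hex_edge n m (j - 1)}" (is "?L = ?R")
  proof (intro equalityI subsetI)
    fix e assume "e \<in> ?L"
    then obtain p q where e: "e = hex_edge n p q" "q < 6" "glue n (m, j) \<in> hex_edge n p q"
      by (auto simp: edges_para_chain)
    then have "p = m \<and> (q = j \<or> (q + 1) mod 6 = j)"
      using only by (auto simp: hex_edge_def)
    moreover have "q = j - 1" if "(q + 1) mod 6 = j"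
      using that j less_6_cases[OF e(2)] by (elim disjE) auto
    ultimately show "e \<in> ?R" using e by auto
  next
    have "hex_edge n m j \<in> edges (para_chain n)" "hex_edge n m (j - 1) \<in> edges (para_chain n)"
      using m j by (auto simp: edges_para_chain)
    moreover have "glue n (m, j) \<in> hex_edge n m j" "glue n (m, j) \<in> hex_edge n m (j - 1)"
      using j by (auto simp: hex_edge_def)
    moreover fix e assume "e \<in> ?R"
    ultimately show "e \<in> ?L" by auto
  qed
  moreover have "hex_edge n m j \<noteq> hex_edge n m (j - 1)"
    using inj_on_eq_iff[OF hex_edge_inj, of "(m, j)" n "(m, j - 1)"] m j by auto
  ultimately show ?thesis by (simp add: degree_def)
qed

lemma degree_pos:
  assumes "finite (edges G)" "e \<in> edges G" "u \<in> e"
  shows "degree G u > 0"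
  using assms by (auto simp: degree_def card_gt_0_iff)

lemma ABC_para_chain: "ABC (para_chain n) = 3 * real n * sqrt 2"
proof -
  let ?d = "degree (para_chain n)"
  define F where
    "F u v = sqrt ((real (?d u) + real (?d v) - 2) / (real (?d u) * real (?d v)))" for u v
  have F_sym: "F u v = F v u" for u v
    by (simp add: F_def add.commute mult.commute)
  have F_edge: "F (glue n (i, a)) (glue n (i, (a + 1) mod 6)) = sqrt 2 / 2"
    if i: "i \<in> {1..n}" and a: "a < 6" for i a
  proof -
    define u v where uv: "u = glue n (i, a)" "v = glue n (i, (a + 1) mod 6)"
    have "hex_edge n i a \<in> edges (para_chain n)"
      using i a by (auto simp: edges_para_chain)
    then have pos: "?d u > 0" "?d v > 0"
      using degree_pos[OF finite_edges_para_chain] uv by (auto simp: hex_edge_def)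
    have "?d u = 2 \<or> ?d v = 2"
    proof (cases "a = 0 \<or> a = 3")
      case True
      then show ?thesis
        using degree_inner_vertex[OF i, of "(a + 1) mod 6"] uv by auto
    next
      case False
      then show ?thesis using degree_inner_vertex[OF i a] uv by auto
    qed
    \<comment> \<open>The factor \<open>d\<close> of the other endpoint cancels, as it is positive.\<close>
    then have "(real (?d u) + real (?d v) - 2) / (real (?d u) * real (?d v)) = 1 / 2"
      using pos by auto
    moreover have "sqrt (1 / 2) = sqrt 2 / 2"
      by (rule real_sqrt_unique) (simp_all add: power_divide)
    ultimately show ?thesis unfolding F_def uv by (simp only:)
  qed
  have "ABC (para_chain n) = edge_sum (para_chain n) F"
    by (simp add: ABC_def F_def [abs_def])
  also have "\<dots> = (\<Sum>i=1..n. \<Sum>a<6. F (glue n (i, a)) (glue n (i, (a + 1) mod 6)))"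
    by (rule edge_sum_para_chain) (rule F_sym)
  also have "\<dots> = (\<Sum>i=1..n. \<Sum>a<6::nat. sqrt 2 / 2)"
    by (intro sum.cong refl F_edge) auto
  finally show ?thesis by simp
qed

section \<open>Sums that are symmetric under reversal\<close>

lemma sum_palindrome_even:
  fixes g :: "nat \<Rightarrow> real"
  assumes "\<And>i. i \<in> {1..2 * k} \<Longrightarrow> g (2 * k + 1 - i) = g i"
  shows "(\<Sum>i=1..2 * k. g i) = 2 * (\<Sum>i=1..k. g i)"
proof -
  have "{1..2 * k} = {1..k} \<union> {k + 1..2 * k}" by auto
  then have "(\<Sum>i=1..2 * k. g i) = (\<Sum>i=1..k. g i) + (\<Sum>i=k + 1..2 * k. g i)"
    by (simp only:) (rule sum.union_disjoint; auto)
  also have "(\<Sum>i=k + 1..2 * k. g i) = (\<Sum>i=1..k. g i)"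
    by (rule sum.reindex_bij_witness[of _ "\<lambda>i. 2 * k + 1 - i" "\<lambda>i. 2 * k + 1 - i"])
       (use assms in auto)
  finally show ?thesis by simp
qed

lemma sum_palindrome_odd:
  fixes g :: "nat \<Rightarrow> real"
  assumes "\<And>i. i \<in> {1..2 * k + 1} \<Longrightarrow> g (2 * k + 2 - i) = g i"
  shows "(\<Sum>i=1..2 * k + 1. g i) = 2 * (\<Sum>i=1..k. g i) + g (k + 1)"
proof -
  have "{1..2 * k + 1} = {1..k + 1} \<union> {k + 2..2 * k + 1}" by auto
  then have "(\<Sum>i=1..2 * k + 1. g i) = (\<Sum>i=1..k + 1. g i) + (\<Sum>i=k + 2..2 * k + 1. g i)"
    by (simp only:) (rule sum.union_disjoint; auto)
  also have "(\<Sum>i=k + 2..2 * k + 1. g i) = (\<Sum>i=1..k. g i)"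
    by (rule sum.reindex_bij_witness[of _ "\<lambda>i. 2 * k + 2 - i" "\<lambda>i. 2 * k + 2 - i"])
       (use assms in auto)
  finally show ?thesis by simp
qed

section \<open>The closed formulas\<close>

theorem theorem3p7:
  "(\<forall>n k :: nat. n \<ge> 1 \<longrightarrow> k \<ge> 1 \<longrightarrow>
      (n = 2 * k \<longrightarrow>
        ABC_GG (para_chain n) =
          12 * (\<Sum>i=1..k. sqrt ((10 * real k - 1) /
                 ((10 * real k - 5 * real i + 3) * (5 * real i - 2))))) \<and>
      (n = 2 * k + 1 \<longrightarrow>
        ABC_GG (para_chain n) =
          12 * (\<Sum>i=1..k. sqrt ((10 * real k + 4) /
                 ((10 * real k - 5 * real i + 8) * (5 * real i - 2))))
          + 6 * sqrt (10 * real k + 4) / (5 * real k + 3))) \<and>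
   (\<forall>n :: nat. n \<ge> 2 \<longrightarrow> ABC (para_chain n) = 3 * real n * sqrt 2)"
proof (intro conjI allI impI)
  fix n k :: nat
  define g where
    "g i = sqrt ((5 * real n - 1) / ((5 * real (n - i) + 3) * (5 * real i - 2)))" for i
  have GG: "ABC_GG (para_chain n) = 6 * (\<Sum>i=1..n. g i)"
    unfolding g_def by (rule ABC_GG_para_chain)
  have sym: "g (n + 1 - i) = g i" if "i \<in> {1..n}" for i
  proof -
    have "5 * real (n - (n + 1 - i)) + 3 = 5 * real i - 2"
      "5 * real (n + 1 - i) - 2 = 5 * real (n - i) + 3"
      using that by (auto simp: of_nat_diff)
    then show ?thesis unfolding g_def by (simp only: mult.commute)
  qed
  show "ABC_GG (para_chain n) = 12 * (\<Sum>i=1..k. sqrt ((10 * real k - 1) /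
      ((10 * real k - 5 * real i + 3) * (5 * real i - 2))))" if n: "n = 2 * k"
  proof -
    have "g i = sqrt ((10 * real k - 1) / ((10 * real k - 5 * real i + 3) * (5 * real i - 2)))"
      if "i \<in> {1..k}" for i
    proof -
      have "5 * real (n - i) + 3 = 10 * real k - 5 * real i + 3" "5 * real n = 10 * real k"
        using that n by (auto simp: of_nat_diff)
      then show ?thesis unfolding g_def by (simp only:)
    qed
    then have "(\<Sum>i=1..k. g i) = (\<Sum>i=1..k. sqrt ((10 * real k - 1) /
        ((10 * real k - 5 * real i + 3) * (5 * real i - 2))))"
      by (intro sum.cong) auto
    moreover have "(\<Sum>i=1..n. g i) = 2 * (\<Sum>i=1..k. g i)"
      unfolding n using sym unfolding n by (rule sum_palindrome_even)
    ultimately show ?thesis unfolding GG by simp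
  qed
  show "ABC_GG (para_chain n) = 12 * (\<Sum>i=1..k. sqrt ((10 * real k + 4) /
      ((10 * real k - 5 * real i + 8) * (5 * real i - 2))))
      + 6 * sqrt (10 * real k + 4) / (5 * real k + 3)" if n: "n = 2 * k + 1"
  proof -
    have num: "5 * real n - 1 = 10 * real k + 4" using n by simp
    have "g i = sqrt ((10 * real k + 4) / ((10 * real k - 5 * real i + 8) * (5 * real i - 2)))"
      if "i \<in> {1..k}" for i
    proof -
      have "5 * real (n - i) + 3 = 10 * real k - 5 * real i + 8"
        using that n by (auto simp: of_nat_diff)
      then show ?thesis unfolding g_def num by (simp only:)
    qed
    then have "(\<Sum>i=1..k. g i) = (\<Sum>i=1..k. sqrt ((10 * real k + 4) /
        ((10 * real k - 5 * real i + 8) * (5 * real i - 2))))"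
      by (intro sum.cong) auto
    moreover have "g (k + 1) = sqrt (10 * real k + 4) / (5 * real k + 3)"
    proof -
      have "5 * real (n - (k + 1)) + 3 = 5 * real k + 3" "5 * real (k + 1) - 2 = 5 * real k + 3"
        using n by auto
      then have "g (k + 1) = sqrt ((10 * real k + 4) / (5 * real k + 3)\<^sup>2)"
        unfolding g_def num power2_eq_square by (simp only:)
      then show ?thesis by (simp add: real_sqrt_divide)
    qed
    moreover have "(\<Sum>i=1..n. g i) = 2 * (\<Sum>i=1..k. g i) + g (k + 1)"
      unfolding n by (rule sum_palindrome_odd) (use sym n in simp)
    ultimately show ?thesis unfolding GG by simp
  qed
qed (rule ABC_para_chain)

end
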